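(* With $P_1,P_2,P_3,P$ and $[M,A,N]$ as defined in the context: (i) $P_1=\{X\in\mathcal M_{mn}:\operatorname{rank}(XJ)=\operatorname{rank}(X)\}=\{X\in\mathcal M_{mn}:\operatorname{Col}(XJ)=\operatorname{Col}(X)\}$; (ii) $P_2=\{X\in\mathcal M_{mn}:\operatorname{rank}(JX)=\operatorname{rank}(X)\}=\{X\in\mathcal M_{mn}:\operatorname{Row}(JX)=\operatorname{Row}(X)\}$; (iii) $P_3=P=\{X\in\mathcal M_{mn}:\operatorname{rank}(JXJ)=\operatorname{rank}(X)\}=\{[M,A,N]: A\in\mathcal M_r,\ M\in\mathcal M_{m-r,r},\ N\in\mathcal M_{r,n-r}\}$; (iv) $P=\operatorname{Reg}(\mathcal M_{mn}^J)$ is the set of all regular elements of $\mathcal M_{mn}^J$, and is a subsemigroup of $\mathcal M_{mn}^J$.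
   Context: Let $\mathbb F$ be a field, $m,n\geq1$ integers, and $0\leq r\leq\min(m,n)$. $\mathcal M_{kl}$ denotes the set of all $k\times l$ matrices over $\mathbb F$ (if $k=0$ or $l=0$ it consists of a single empty matrix), $\mathcal M_k=\mathcal M_{kk}$, and $\mathcal M=\bigcup_{k,l\geq1}\mathcal M_{kl}$. Let $J=\begin{bmatrix}I_r&O\\O&O\end{bmatrix}\in\mathcal M_{nm}$ (an $n\times m$ matrix), and let $\mathcal M_{mn}^J$ be the semigroup with underlying set $\mathcal M_{mn}$ and operation $X\star Y=XJY$. Row and column spaces are denoted $\operatorname{Row}(X)$ and $\operatorname{Col}(X)$. For $X,Y\in\mathcal M$ (matrices of any sizes): $X\mathrel{\mathcal R}Y$ iff $X=YA$ and $Y=XB$ for some $A,B\in\mathcal M$; $X\mathrel{\mathcal L}Y$ iff $X=AY$ and $Y=BX$ for some $A,B\in\mathcal M$; $X\mathrel{\mathcal J}Y$ iff $X=AYB$ and $Y=CXD$ for some $A,B,C,D\in\mathcal M$. Define $P_1=\{X\in\mathcal M_{mn}:XJ\mathrel{\mathcal R}X\}$, $P_2=\{X\in\mathcal M_{mn}:JX\mathrel{\mathcal L}X\}$, $P_3=\{X\in\mathcal M_{mn}:JXJ\mathrel{\mathcal J}X\}$, $P=P_1\cap P_2$. For $A\in\mathcal M_r$, $M\in\mathcal M_{m-r,r}$, $N\in\mathcal M_{r,n-r}$, put $[M,A,N]=\begin{bmatrix}A&AN\\ MA&MAN\end{bmatrix}\in\mathcal M_{mn}$ (empty blocks are omitted).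 An element $x$ of a semigroup $T$ is regular if $x=xyx$ for some $y\in T$; $\operatorname{Reg}(T)$ is the set of regular elements. *)

theory Defs
  imports
    "Jordan_Normal_Form.Matrix"
    "Jordan_Normal_Form.VS_Connect"
    "Jordan_Normal_Form.DL_Rank"
begin

text \<open>
  The library's rank, row space and column space carry the dimension of the ambient space of
  rows or columns as an explicit parameter; here it is read off from the matrix.
\<close>

definition mrank :: "'a::field mat \<Rightarrow> nat" where
  "mrank X = vec_space.rank (dim_row X) X"

definition Col :: "'a::field mat \<Rightarrow> 'a vec set" where
  "Col X = vec_space.col_space (dim_row X) X"

definition Row :: "'a::field mat \<Rightarrow> 'a vec set" where
  "Row X = vec_space.row_space (dim_col X) X"

definition nonempty_mats :: "'a mat set" where
  "nonempty_mats = {A. dim_row A \<ge> 1 \<and> dim_col A \<ge> 1}"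

text \<open>
  Matrix multiplication is partial in the mathematics but total in the library, so
  compatibility of the sizes in every product is required explicitly.
\<close>

definition green_R :: "'a::field mat \<Rightarrow> 'a mat \<Rightarrow> bool" where
  "green_R X Y \<longleftrightarrow>
     (\<exists>A\<in>nonempty_mats. dim_col Y = dim_row A \<and> X = Y * A) \<and>
     (\<exists>B\<in>nonempty_mats. dim_col X = dim_row B \<and> Y = X * B)"

definition green_L :: "'a::field mat \<Rightarrow> 'a mat \<Rightarrow> bool" where
  "green_L X Y \<longleftrightarrow>
     (\<exists>A\<in>nonempty_mats. dim_col A = dim_row Y \<and> X = A * Y) \<and>
     (\<exists>B\<in>nonempty_mats. dim_col B = dim_row X \<and> Y = B * X)"

definition green_J :: "'a::field mat \<Rightarrow> 'a mat \<Rightarrow> bool" where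
  "green_J X Y \<longleftrightarrow>
     (\<exists>A\<in>nonempty_mats. \<exists>B\<in>nonempty_mats.
        dim_col A = dim_row Y \<and> dim_col Y = dim_row B \<and> X = A * Y * B) \<and>
     (\<exists>C\<in>nonempty_mats. \<exists>D\<in>nonempty_mats.
        dim_col C = dim_row X \<and> dim_col X = dim_row D \<and> Y = C * X * D)"

text \<open>
  The \<open>n \<times> m\<close> matrix with identity block of size \<open>r\<close>; note the order of the dimensions
  (the elements of the sandwich semigroup are \<open>m \<times> n\<close>).
\<close>

definition Jmat :: "nat \<Rightarrow> nat \<Rightarrow> nat \<Rightarrow> 'a::field mat" where
  "Jmat m n r = four_block_mat (1\<^sub>m r) (0\<^sub>m r (m - r)) (0\<^sub>m (n - r) r) (0\<^sub>m (n - r) (m - r))"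

definition sandwich :: "nat \<Rightarrow> nat \<Rightarrow> nat \<Rightarrow> 'a::field mat \<Rightarrow> 'a mat \<Rightarrow> 'a mat" where
  "sandwich m n r X Y = X * Jmat m n r * Y"

definition P1 :: "nat \<Rightarrow> nat \<Rightarrow> nat \<Rightarrow> 'a::field mat set" where
  "P1 m n r = {X \<in> carrier_mat m n. green_R (X * Jmat m n r) X}"

definition P2 :: "nat \<Rightarrow> nat \<Rightarrow> nat \<Rightarrow> 'a::field mat set" where
  "P2 m n r = {X \<in> carrier_mat m n. green_L (Jmat m n r * X) X}"

definition P3 :: "nat \<Rightarrow> nat \<Rightarrow> nat \<Rightarrow> 'a::field mat set" where
  "P3 m n r = {X \<in> carrier_mat m n. green_J (Jmat m n r * X * Jmat m n r) X}"

definition P :: "nat \<Rightarrow> nat \<Rightarrow> nat \<Rightarrow> 'a::field mat set" where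
  "P m n r = P1 m n r \<inter> P2 m n r"

definition block_triple :: "'a::field mat \<Rightarrow> 'a mat \<Rightarrow> 'a mat \<Rightarrow> 'a mat" where
  "block_triple M A N = four_block_mat A (A * N) (M * A) (M * A * N)"

text \<open>Semigroups are given by a carrier set and a binary operation.\<close>

definition semigroup_on :: "'b set \<Rightarrow> ('b \<Rightarrow> 'b \<Rightarrow> 'b) \<Rightarrow> bool" where
  "semigroup_on S f \<longleftrightarrow>
     (\<forall>x\<in>S. \<forall>y\<in>S. f x y \<in> S) \<and>
     (\<forall>x\<in>S. \<forall>y\<in>S. \<forall>z\<in>S. f (f x y) z = f x (f y z))"

definition subsemigroup_on :: "'b set \<Rightarrow> 'b set \<Rightarrow> ('b \<Rightarrow> 'b \<Rightarrow> 'b) \<Rightarrow> bool" where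
  "subsemigroup_on T S f \<longleftrightarrow>
     semigroup_on S f \<and> T \<subseteq> S \<and> T \<noteq> {} \<and> (\<forall>x\<in>T. \<forall>y\<in>T. f x y \<in> T)"

definition Reg :: "'b set \<Rightarrow> ('b \<Rightarrow> 'b \<Rightarrow> 'b) \<Rightarrow> 'b set" where
  "Reg S f = {x \<in> S. \<exists>y\<in>S. x = f (f x y) x}"

end

theory Submission
  imports Defs
begin

text \<open>
  Write \<open>X = U V\<close> with inner dimension equal to the rank. This factorization gives the equality
  of row and column rank, and, after inverting \<open>U\<close> on the left and \<open>V\<close> on the right, the von Neumann
  regularity of every matrix. The relations \<open>\<R>\<close> and \<open>\<L>\<close> amount to equality of column and row
  spaces, and since multiplication can only shrink these spaces, equality is detected by rank.
  Elements of \<open>P\<close> are those with \<open>X = X J A = B J X\<close>; then \<open>X = B (J X J) A\<close>, so \<open>X\<close> is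
  \<open>\<J>\<close>-related to \<open>J X J\<close>, and an inner inverse \<open>Z\<close> of \<open>J X J\<close> satisfies \<open>X J Z J X = X\<close>.
  Comparing blocks in \<open>X = X J A = B J X\<close> yields the shape \<open>[M, A, N]\<close>.
\<close>

section \<open>Bases of column spaces and comparison of ranks\<close>

lemma (in vec_space) rank_basis:
  assumes A: "A \<in> carrier_mat n nc"
  obtains S where "S \<subseteq> set (cols A)" "finite S" "lin_indpt S"
    "span S = span (set (cols A))" "card S = rank A"
proof -
  have cA: "set (cols A) \<subseteq> carrier_vec n"
    using cols_dim A by blast
  \<comment> \<open>The empty set is independent and independent sets of columns are bounded by the
    finite number of columns, so a maximal one exists.\<close>
  obtain S where S: "maximal S (\<lambda>T. T \<subseteq> set (cols A) \<and> lin_indpt T)"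
    using maximal_exists[of "(\<lambda>T. T \<subseteq> set (cols A) \<and> lin_indpt T)" "card (set (cols A))" "{}"]
    by (meson List.finite_set card_mono empty_iff empty_subsetI finite_lin_indpt2 rev_finite_subset)
  then have SA: "S \<subseteq> set (cols A)" and li: "lin_indpt S"
    by (auto simp: maximal_def)
  have cS: "S \<subseteq> carrier_vec n" using SA cA by blast
  have "set (cols A) \<subseteq> span S"
  proof
    fix s assume s: "s \<in> set (cols A)"
    show "s \<in> span S"
    proof (rule ccontr)
      assume ns: "s \<notin> span S"
      then have sS: "s \<notin> S" using in_own_span[OF cS] by blast
      \<comment> \<open>A column outside the span could be adjoined to \<open>S\<close> without
        destroying independence, against maximality.\<close>
      have "lin_indpt (S \<union> {s})"
        using lin_dep_iff_in_span[OF cS li _ sS] s cA ns by blast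
      with S s SA have "S \<union> {s} = S" unfolding maximal_def by blast
      with sS show False by blast
    qed
  qed
  then have "span (set (cols A)) = span S"
    using span_is_monotone[OF SA] span_subsetI[OF cS] by blast
  then show thesis
    using that[OF SA _ li] rank_card_indpt[OF A S] SA finite_subset by fastforce
qed

text \<open>A basis of the smaller column space is an independent subset of the larger one, whose
  dimension is \<open>rank Y\<close>. So it has at most \<open>rank Y\<close> elements, and if it
  has exactly that many, it spans the larger space too.\<close>

lemma (in vec_space)
  assumes X: "X \<in> carrier_mat n p" and Y: "Y \<in> carrier_mat n q"
    and sub: "col_space X \<subseteq> col_space Y"
  shows rank_mono_col_space: "rank X \<le> rank Y"
    and col_space_eq_if_rank_eq: "rank X = rank Y \<Longrightarrow> col_space X = col_space Y"
proof -
  let ?W = "span (set (cols Y))"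
  have cX: "set (cols X) \<subseteq> carrier_vec n" and cY: "set (cols Y) \<subseteq> carrier_vec n"
    using cols_dim X Y by blast+
  obtain S where S: "S \<subseteq> set (cols X)" "finite S" "lin_indpt S"
    "span S = span (set (cols X))" "card S = rank X"
    by (rule rank_basis[OF X])
  have subm: "submodule class_ring ?W V" using span_is_submodule[OF cY] .
  interpret W: vectorspace class_ring "vs ?W"
    using span_is_subspace[THEN subspace_is_vs, of "set (cols Y)"] cY by auto
  have fd: "W.fin_dim" using fin_dim_span_cols[OF Y] .
  have SW: "S \<subseteq> ?W"
    using S(1) in_own_span[OF cX] sub by (auto simp: col_space_def)
  \<comment> \<open>Independence and spans are the same whether computed in the ambient space or in
    the subspace \<open>?W\<close>. The dimension theorems are then applied inside
    \<open>?W\<close>.\<close>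
  have liW: "W.lin_indpt S"
    using span_li_not_depend(2)[OF SW subm] S(3) by simp
  have SW': "S \<subseteq> carrier (vs ?W)" using SW by simp
  show "rank X \<le> rank Y"
    using W.li_le_dim(2)[OF fd SW' liW] S(5) by (simp add: rank_def)
  assume eq: "rank X = rank Y"
  have "W.basis S"
    using W.dim_li_is_basis[OF fd S(2) SW' liW] S(5) eq by (simp add: rank_def)
  then have "W.gen_set S" by (simp add: W.basis_def)
  then have "span S = ?W"
    using span_li_not_depend(1)[OF SW subm] by simp
  with S(4) show "col_space X = col_space Y" by (simp add: col_space_def)
qed

lemma (in vec_space) col_in_col_space:
  assumes "X \<in> carrier_mat n p" "j < p"
  shows "col X j \<in> col_space X"
proof -
  have "set (cols X) \<subseteq> carrier_vec n" "col X j \<in> set (cols X)"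
    using cols_dim assms by (auto simp: cols_def)
  then show ?thesis using in_own_span by (auto simp: col_space_def)
qed

section \<open>Column spaces as ranges, and factorization through them\<close>

lemma Col_eq_range:
  "Col X = {X *\<^sub>v v | v. v \<in> carrier_vec (dim_col X)}"
  unfolding Col_def by (subst vec_space.col_space_eq[of _ _ "dim_col X"]) (auto intro!: carrier_vecI)

lemma Col_mult_subset:
  assumes "dim_row A = dim_col Y"
  shows "Col (Y * A) \<subseteq> Col Y"
proof
  fix w assume "w \<in> Col (Y * A)"
  then obtain v where v: "v \<in> carrier_vec (dim_col A)" and w: "w = (Y * A) *\<^sub>v v"
    unfolding Col_eq_range by auto
  have "w = Y *\<^sub>v (A *\<^sub>v v)"
    unfolding w using assoc_mult_mat_vec[of Y _ "dim_row A" A _ v] v assms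
    by (metis carrier_mat_triv)
  moreover have "A *\<^sub>v v \<in> carrier_vec (dim_col Y)"
    using assms by (intro carrier_vecI) simp
  ultimately show "w \<in> Col Y" unfolding Col_eq_range by blast
qed

lemma col_in_Col: "j < dim_col X \<Longrightarrow> col X j \<in> Col X"
  unfolding Col_def
  by (rule vec_space.col_in_col_space[of _ _ "dim_col X"]) auto

text \<open>Each column of \<open>X\<close> is \<open>Y\<close> applied to some vector; the chosen
  vectors are the columns of \<open>A\<close>. This is the converse of
  \<open>Col_mult_subset\<close> and the source of all matrix factors obtained below.\<close>

lemma Col_subset_factor:
  assumes rows: "dim_row X = dim_row Y" and sub: "Col X \<subseteq> Col Y"
  obtains A where "A \<in> carrier_mat (dim_col Y) (dim_col X)" "X = Y * A"
proof -
  have "\<exists>v. v \<in> carrier_vec (dim_col Y) \<and> col X j = Y *\<^sub>v v" if "j < dim_col X" for j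
    using col_in_Col[OF that] sub unfolding Col_eq_range[of Y] by blast
  then have "\<exists>f. \<forall>j<dim_col X. f j \<in> carrier_vec (dim_col Y) \<and> col X j = Y *\<^sub>v f j"
    by (intro choice) blast
  then obtain f where f: "\<And>j. j < dim_col X \<Longrightarrow> f j \<in> carrier_vec (dim_col Y)"
      "\<And>j. j < dim_col X \<Longrightarrow> col X j = Y *\<^sub>v f j"
    by blast
  define A where "A = mat_of_cols (dim_col Y) (map f [0..<dim_col X])"
  have A: "A \<in> carrier_mat (dim_col Y) (dim_col X)"
    unfolding A_def by (rule carrier_matI) simp_all
  have colA: "col A j = f j" if "j < dim_col X" for j
    using that f(1)[OF that] by (simp add: A_def)
  have "X = Y * A"
  proof (rule mat_col_eqI)
    fix j assume "j < dim_col (Y * A)"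
    then have j: "j < dim_col X" using A by simp
    show "col X j = col (Y * A) j"
      using col_mult2[OF _ A j, of Y "dim_row Y"] f(2)[OF j] colA[OF j] by auto
  qed (use A rows in auto)
  with A that show thesis by blast
qed

section \<open>Rank inequalities, rank factorization and inner inverses\<close>

lemma mrank_le_dim_col: "mrank X \<le> dim_col X"
  unfolding mrank_def by (rule vec_space.rank_le_nc[of _ _ "dim_col X"]) auto

lemma mrank_mono_Col:
  assumes "dim_row X = dim_row Y" and "Col X \<subseteq> Col Y"
  shows "mrank X \<le> mrank Y"
  using assms unfolding mrank_def Col_def
  by (metis carrier_mat_triv vec_space.rank_mono_col_space)

lemma Col_eq_if_mrank_eq:
  assumes "dim_row X = dim_row Y" and "Col X \<subseteq> Col Y" and "mrank X = mrank Y"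
  shows "Col X = Col Y"
  using assms unfolding mrank_def Col_def
  by (metis carrier_mat_triv vec_space.col_space_eq_if_rank_eq)

lemma mrank_mult_left_le:
  assumes "dim_row A = dim_col Y"
  shows "mrank (Y * A) \<le> mrank Y"
  using mrank_mono_Col[OF _ Col_mult_subset[OF assms]] by simp

text \<open>The columns of \<open>U\<close> form a basis of the column space of \<open>X\<close>,
  chosen among the columns of \<open>X\<close>; \<open>V\<close> holds the coordinates of the
  columns of \<open>X\<close> in that basis.\<close>

lemma rank_factorization:
  assumes X: "X \<in> carrier_mat m n"
  obtains U V where "U \<in> carrier_mat m (mrank X)" "V \<in> carrier_mat (mrank X) n" "X = U * V"
proof -
  have X': "X \<in> carrier_mat (dim_row X) (dim_col X)" by simp
  obtain S where S: "S \<subseteq> set (cols X)" "finite S"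
      "LinearCombinations.module.span class_ring (module_vec TYPE('a) (dim_row X)) S = Col X"
      "card S = mrank X"
    by (rule vec_space.rank_basis[OF X']) (auto simp: mrank_def Col_def vec_space.col_space_def)
  \<comment> \<open>Listing the basis without repetition makes the number of columns of
    \<open>U\<close> exactly \<open>mrank X\<close>.\<close>
  obtain us where us: "set us = S" "distinct us"
    using finite_distinct_list[OF S(2)] by blast
  define U where "U = mat_of_cols m us"
  have "set us \<subseteq> carrier_vec m"
    using us(1) S(1) cols_dim[of X] X by auto
  then have "cols U = us" by (simp add: U_def cols_mat_of_cols)
  moreover have U: "U \<in> carrier_mat m (mrank X)"
    using distinct_card[OF us(2)] us(1) S(4) by (simp add: U_def)
  ultimately have CU: "Col U = Col X"
    using S(3) X us(1) by (simp add: Col_def vec_space.col_space_def)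
  have rows: "dim_row X = dim_row U" using X U by simp
  obtain V where V: "V \<in> carrier_mat (dim_col U) (dim_col X)" and XUV: "X = U * V"
    by (rule Col_subset_factor[OF rows equalityD2[OF CU]])
  show thesis
    by (rule that[OF U _ XUV]) (use U V X in auto)
qed

text \<open>In a rank factorization \<open>Y = U * V\<close>, the transpose of \<open>Y\<close> has
  the transpose of \<open>V\<close> as its left factor, and that has only \<open>mrank Y\<close>
  columns. Applying the bound to the transpose as well gives equality.\<close>

lemma mrank_transpose [simp]: "mrank X\<^sup>T = mrank X"
proof -
  have le: "mrank Y\<^sup>T \<le> mrank Y" for Y :: "'a mat"
  proof -
    obtain U V where U: "U \<in> carrier_mat (dim_row Y) (mrank Y)"
      and V: "V \<in> carrier_mat (mrank Y) (dim_col Y)" and Y: "Y = U * V"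
      by (rule rank_factorization[OF carrier_mat_triv[of Y]])
    have "mrank Y\<^sup>T = mrank (V\<^sup>T * U\<^sup>T)"
      using transpose_mult[OF U V] Y by simp
    also have "\<dots> \<le> mrank V\<^sup>T"
      using U V by (intro mrank_mult_left_le) auto
    also have "\<dots> \<le> mrank Y"
      using mrank_le_dim_col[of "V\<^sup>T"] V by simp
    finally show ?thesis .
  qed
  from le[of X] le[of "X\<^sup>T"] show ?thesis by simp
qed

lemma transpose_mult_dims:
  "dim_col A = dim_row B \<Longrightarrow> (A * B)\<^sup>T = B\<^sup>T * (A\<^sup>T :: 'a::comm_semiring_0 mat)"
  by (metis carrier_mat_triv transpose_mult)

lemma mrank_mult_right_le:
  assumes "dim_col A = dim_row Y"
  shows "mrank (A * Y) \<le> mrank Y"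
  using mrank_mult_left_le[of "A\<^sup>T" "Y\<^sup>T"] transpose_mult_dims[OF assms] assms mrank_transpose
  by (metis index_transpose_mat(2,3))

lemma Row_eq_Col_transpose: "Row X = Col X\<^sup>T"
  by (simp add: Row_def Col_def vec_space.row_space_eq_col_space_transpose)

text \<open>Full row rank makes the column space of \<open>A\<close> equal to that of the identity,
  so the identity factors through \<open>A\<close>.\<close>

lemma full_row_rank_right_inverse:
  fixes A :: "'a::field mat"
  assumes A: "A \<in> carrier_mat k l" and "k \<le> mrank A"
  obtains B where "B \<in> carrier_mat l k" "A * B = 1\<^sub>m k"
proof -
  have sub: "Col A \<subseteq> Col (1\<^sub>m k)"
    using Col_mult_subset[of A "1\<^sub>m k"] A by simp
  \<comment> \<open>The rank of the identity is squeezed: \<open>mrank A\<close> \<le>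
    \<open>mrank (1\<^sub>m k)\<close> \<le> \<open>k\<close> \<le> \<open>mrank A\<close>.\<close>
  moreover have "mrank A = mrank (1\<^sub>m k :: 'a mat)"
    using mrank_mono_Col[OF _ sub] mrank_le_dim_col[of "1\<^sub>m k :: 'a mat"] assms by simp
  ultimately have C1: "Col (1\<^sub>m k) = Col A"
    using Col_eq_if_mrank_eq[of A "1\<^sub>m k"] A by simp
  have rows: "dim_row (1\<^sub>m k :: 'a mat) = dim_row A" using A by simp
  obtain B where B: "B \<in> carrier_mat (dim_col A) (dim_col (1\<^sub>m k :: 'a mat))"
      and AB: "1\<^sub>m k = A * B"
    by (rule Col_subset_factor[OF rows equalityD1[OF C1]])
  show thesis
    by (rule that[OF _ AB[symmetric]]) (use A B in auto)
qed

lemma mult_mat_assoc: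
  "dim_col A = dim_row B \<Longrightarrow> dim_col B = dim_row C \<Longrightarrow>
    A * B * C = A * (B * (C :: 'a::semiring_0 mat))"
  by (metis assoc_mult_mat carrier_mat_triv)

text \<open>In a rank factorization \<open>U * V\<close> the factor \<open>U\<close> has a left
  inverse and \<open>V\<close> a right inverse; their product in reverse order is an inner
  inverse.\<close>

lemma von_Neumann_regular_mat:
  fixes X :: "'a::field mat"
  assumes X: "X \<in> carrier_mat m n"
  obtains Z where "Z \<in> carrier_mat n m" "X * Z * X = X"
proof -
  let ?k = "mrank X"
  obtain U V where U: "U \<in> carrier_mat m ?k" and V: "V \<in> carrier_mat ?k n" and XUV: "X = U * V"
    by (rule rank_factorization[OF X])
  \<comment> \<open>A product has rank at most that of each factor, so both factors have full rank
    \<open>?k\<close>.\<close>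
  have "?k \<le> mrank U\<^sup>T" "?k \<le> mrank V"
    using mrank_mult_left_le[of V U] mrank_mult_right_le[of U V] U V XUV by auto
  then obtain W V' where W: "W \<in> carrier_mat m ?k" "U\<^sup>T * W = 1\<^sub>m ?k"
    and V': "V' \<in> carrier_mat n ?k" "V * V' = 1\<^sub>m ?k"
    using full_row_rank_right_inverse[of "U\<^sup>T" ?k m] full_row_rank_right_inverse[of V ?k n] U V
    by (metis transpose_carrier_mat)
  have WU: "W\<^sup>T * U = 1\<^sub>m ?k"
    using transpose_mult[of "U\<^sup>T" ?k m W ?k] U W by simp
  have "X * (V' * W\<^sup>T) * X = U * (V * V') * (W\<^sup>T * U) * V"
    unfolding XUV using U V W(1) V'(1) by (simp add: mult_mat_assoc)
  also have "\<dots> = X"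
    using U V V'(2) WU XUV by simp
  finally show thesis
    using that[of "V' * W\<^sup>T"] V'(1) W(1) by simp
qed

section \<open>Green's relations in terms of row spaces, column spaces and rank\<close>

lemma green_R_iff_Col:
  assumes "dim_row X = dim_row Y" "1 \<le> dim_col X" "1 \<le> dim_col Y"
  shows "green_R X Y \<longleftrightarrow> Col X = Col Y"
proof
  assume "green_R X Y"
  then show "Col X = Col Y"
    unfolding green_R_def by (metis Col_mult_subset subset_antisym)
next
  assume eq: "Col X = Col Y"
  obtain A where A: "A \<in> carrier_mat (dim_col Y) (dim_col X)" and XA: "X = Y * A"
    by (rule Col_subset_factor[OF assms(1) equalityD1[OF eq]])
  obtain B where B: "B \<in> carrier_mat (dim_col X) (dim_col Y)" and YB: "Y = X * B"
    by (rule Col_subset_factor[OF assms(1)[symmetric] equalityD2[OF eq]])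
  \<comment> \<open>Both factors have their sizes among the column numbers of \<open>X\<close> and
    \<open>Y\<close>, which are positive.\<close>
  have "A \<in> nonempty_mats" "B \<in> nonempty_mats"
    using A B assms(2,3) by (auto simp: nonempty_mats_def)
  with XA YB A B show "green_R X Y"
    unfolding green_R_def by (metis carrier_matD(1))
qed

text \<open>Transposition swaps left and right multiplication, so facts about \<L> and rows are
  inherited from \<R> and columns.\<close>

lemma green_L_iff_green_R_transpose: "green_L X Y \<longleftrightarrow> green_R X\<^sup>T Y\<^sup>T"
proof -
  have "(\<exists>A\<in>nonempty_mats. dim_col A = dim_row W \<and> V = A * W) \<longleftrightarrow>
      (\<exists>A\<in>nonempty_mats. dim_col W\<^sup>T = dim_row A \<and> V\<^sup>T = W\<^sup>T * A)" for V W :: "'a mat"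
  proof
    assume "\<exists>A\<in>nonempty_mats. dim_col A = dim_row W \<and> V = A * W"
    then obtain A where "A \<in> nonempty_mats" "dim_col A = dim_row W" "V = A * W" by blast
    then show "\<exists>A\<in>nonempty_mats. dim_col W\<^sup>T = dim_row A \<and> V\<^sup>T = W\<^sup>T * A"
      by (intro bexI[of _ "A\<^sup>T"]) (auto simp: transpose_mult_dims nonempty_mats_def)
  next
    assume "\<exists>A\<in>nonempty_mats. dim_col W\<^sup>T = dim_row A \<and> V\<^sup>T = W\<^sup>T * A"
    then obtain A where A: "A \<in> nonempty_mats" "dim_row A = dim_row W" "V\<^sup>T = W\<^sup>T * A"
      by auto
    then have "V = A\<^sup>T * W"
      using transpose_mult_dims[of "W\<^sup>T" A] by (metis index_transpose_mat(3) transpose_transpose)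
    with A(1,2) show "\<exists>A\<in>nonempty_mats. dim_col A = dim_row W \<and> V = A * W"
      by (intro bexI[of _ "A\<^sup>T"]) (auto simp: nonempty_mats_def)
  qed
  then show ?thesis unfolding green_L_def green_R_def by simp
qed

lemma green_L_iff_Row:
  assumes "dim_col X = dim_col Y" "1 \<le> dim_row X" "1 \<le> dim_row Y"
  shows "green_L X Y \<longleftrightarrow> Row X = Row Y"
  unfolding green_L_iff_green_R_transpose Row_eq_Col_transpose
  using assms by (intro green_R_iff_Col) auto

text \<open>Multiplying on either side cannot raise the rank, and each of the two matrices is such a
  multiple of the other.\<close>

lemma green_J_imp_mrank_eq:
  assumes "green_J X Y"
  shows "mrank X = mrank Y"
proof -
  have "mrank (A * Z * B) \<le> mrank Z" if "dim_col A = dim_row Z" "dim_col Z = dim_row B"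
    for A Z B :: "'a mat"
    using mrank_mult_left_le[of B "A * Z"] mrank_mult_right_le[of A Z] that by simp
  with assms show ?thesis
    unfolding green_J_def by (metis order_antisym)
qed

section \<open>Multiplication by an arbitrary matrix \<open>J\<close> of compatible size\<close>

lemma Col_mult_eq_iff_mrank:
  assumes "dim_row J = dim_col X"
  shows "Col (X * J) = Col X \<longleftrightarrow> mrank (X * J) = mrank X"
  using Col_eq_if_mrank_eq[of "X * J" X] mrank_mono_Col[of "X * J" X] mrank_mono_Col[of X "X * J"]
    Col_mult_subset[OF assms] by (auto intro: order_antisym)

lemma Row_mult_eq_iff_mrank:
  assumes "dim_col J = dim_row X"
  shows "Row (J * X) = Row X \<longleftrightarrow> mrank (J * X) = mrank X"
  using Col_mult_eq_iff_mrank[of "J\<^sup>T" "X\<^sup>T"] assms mrank_transpose[of "J * X"]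
  by (simp add: Row_eq_Col_transpose transpose_mult_dims)

lemma Col_mult_eqE:
  assumes "Col (X * J) = Col X"
  obtains A where "A \<in> carrier_mat (dim_col J) (dim_col X)" "X = X * J * A"
proof -
  have "dim_row X = dim_row (X * J)" by simp
  then obtain A where "A \<in> carrier_mat (dim_col (X * J)) (dim_col X)" "X = X * J * A"
    using equalityD2[OF assms] by (rule Col_subset_factor)
  with that show thesis by (metis index_mult_mat(3))
qed

lemma Row_mult_eqE:
  assumes "dim_col J = dim_row X" "Row (J * X) = Row X"
  obtains B where "B \<in> carrier_mat (dim_row X) (dim_row J)" "X = B * (J * X)"
proof -
  have "Col (X\<^sup>T * J\<^sup>T) = Col X\<^sup>T"
    using assms by (simp add: Row_eq_Col_transpose transpose_mult_dims)
  then obtain A where A: "A \<in> carrier_mat (dim_row J) (dim_row X)" "X\<^sup>T = X\<^sup>T * J\<^sup>T * A"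
    by (rule Col_mult_eqE) simp
  have "(X\<^sup>T * J\<^sup>T * A)\<^sup>T = A\<^sup>T * (J * X)"
    using A(1) assms(1) by (simp add: transpose_mult_dims)
  then have "X = A\<^sup>T * (J * X)"
    using A(2) by (metis transpose_transpose)
  with A(1) that show thesis by (metis transpose_carrier_mat)
qed

text \<open>Both one-sided ranks lie between the rank of \<open>J * X * J\<close> and that of
  \<open>X\<close>. Conversely, equal row spaces give \<open>X = B * (J * X)\<close>, so left
  multiplication by \<open>B\<close> recovers \<open>X * J\<close> from \<open>J * X * J\<close> and
  no rank is lost.\<close>

lemma mrank_two_sided_eq_iff:
  assumes "dim_row J = dim_col X" "dim_col J = dim_row X"
  shows "mrank (J * X * J) = mrank X \<longleftrightarrow> mrank (X * J) = mrank X \<and> mrank (J * X) = mrank X"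
proof
  assume "mrank (J * X * J) = mrank X"
  moreover have "mrank (J * X * J) \<le> mrank (X * J)"
    using mrank_mult_right_le[of J "X * J"] assms by (simp add: mult_mat_assoc)
  moreover have "mrank (J * X * J) \<le> mrank (J * X)"
    using mrank_mult_left_le[of J "J * X"] assms by simp
  ultimately show "mrank (X * J) = mrank X \<and> mrank (J * X) = mrank X"
    using mrank_mult_left_le[of J X] mrank_mult_right_le[of J X] assms by simp
next
  assume r: "mrank (X * J) = mrank X \<and> mrank (J * X) = mrank X"
  then have "Col (X * J) = Col X" "Row (J * X) = Row X"
    using assms by (simp_all add: Col_mult_eq_iff_mrank Row_mult_eq_iff_mrank)
  then obtain B where B: "dim_col B = dim_row J" "X = B * (J * X)"
    using assms by (metis Row_mult_eqE carrier_matD(2))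
  then have "X * J = B * (J * X * J)"
    using assms by (metis index_mult_mat(2,3) mult_mat_assoc)
  then have "mrank (X * J) \<le> mrank (J * X * J)"
    using mrank_mult_right_le[of B "J * X * J"] B(1) by simp
  moreover have "mrank (J * X * J) \<le> mrank (J * X)"
    using mrank_mult_left_le[of J "J * X"] assms by simp
  ultimately show "mrank (J * X * J) = mrank X" using r by simp
qed

lemma Col_mult_eqI:
  assumes "dim_row J = dim_col X" "dim_row A = dim_col J" "X = X * J * A"
  shows "Col (X * J) = Col X"
proof
  show "Col (X * J) \<subseteq> Col X" by (rule Col_mult_subset[OF assms(1)])
  show "Col X \<subseteq> Col (X * J)"
    by (subst assms(3), rule Col_mult_subset) (simp add: assms(2))
qed

lemma Row_mult_eqI:
  assumes "dim_col J = dim_row X" "dim_col B = dim_row J" "X = B * (J * X)"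
  shows "Row (J * X) = Row X"
proof -
  have "X\<^sup>T = (B * (J * X))\<^sup>T" using assms(3) by (rule arg_cong)
  also have "\<dots> = X\<^sup>T * J\<^sup>T * B\<^sup>T" using assms(1,2) by (simp add: transpose_mult_dims)
  finally have "Col (X\<^sup>T * J\<^sup>T) = Col X\<^sup>T"
    by (rule Col_mult_eqI[rotated 2]) (use assms(1,2) in simp_all)
  then show ?thesis
    using assms(1) by (simp add: Row_eq_Col_transpose transpose_mult_dims)
qed

text \<open>Collects the equations by which \<open>X * J\<close>, \<open>J * X\<close> and finally
  \<open>X\<close> are recovered from \<open>J * X * J\<close>.\<close>

lemma Col_Row_mult_eqE:
  assumes J: "dim_row J = dim_col X" "dim_col J = dim_row X"
    and Col: "Col (X * J) = Col X" and Row: "Row (J * X) = Row X"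
  obtains A B where "A \<in> carrier_mat (dim_row X) (dim_col X)" "B \<in> carrier_mat (dim_row X) (dim_col X)"
    "X * J = B * (J * X * J)" "J * X = J * X * J * A" "X = X * J * A" "X = B * (J * X)"
proof -
  obtain A where A: "A \<in> carrier_mat (dim_col J) (dim_col X)" "X = X * J * A"
    by (rule Col_mult_eqE[OF Col])
  obtain B where B: "B \<in> carrier_mat (dim_row X) (dim_row J)" "X = B * (J * X)"
    by (rule Row_mult_eqE[OF J(2) Row])
  have "X * J = B * (J * X) * J" using B(2) by (rule arg_cong)
  also have "\<dots> = B * (J * X * J)" using B(1) J by (simp add: mult_mat_assoc)
  finally have XJ: "X * J = B * (J * X * J)" .
  have "J * X = J * (X * J * A)" using A(2) by (rule arg_cong)
  also have "\<dots> = J * X * J * A" using A(1) J by (simp add: mult_mat_assoc)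
  finally have JX: "J * X = J * X * J * A" .
  show thesis
    by (rule that[OF _ _ XJ JX A(2) B(2)]) (use A(1) B(1) J in simp_all)
qed

text \<open>One direction is \<open>X = B * (J * X * J) * A\<close>; in the other, \<open>J\<close>
  itself serves as both multipliers.\<close>

lemma green_J_two_sidedI:
  assumes J: "dim_row J = dim_col X" "dim_col J = dim_row X"
    and ne: "1 \<le> dim_row X" "1 \<le> dim_col X"
    and "Col (X * J) = Col X" "Row (J * X) = Row X"
  shows "green_J (J * X * J) X"
proof -
  obtain A B where A: "A \<in> carrier_mat (dim_row X) (dim_col X)"
    and B: "B \<in> carrier_mat (dim_row X) (dim_col X)"
    and XJ: "X * J = B * (J * X * J)" and XA: "X = X * J * A"
    by (rule Col_Row_mult_eqE[OF J assms(5,6)])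
  have "X = B * (J * X * J) * A" unfolding XJ[symmetric] by (rule XA)
  moreover have "J \<in> nonempty_mats" "A \<in> nonempty_mats" "B \<in> nonempty_mats"
    using A B J ne by (simp_all add: nonempty_mats_def)
  moreover have "dim_col B = dim_row (J * X * J)" "dim_col (J * X * J) = dim_row A"
    using A B J by simp_all
  ultimately show ?thesis
    unfolding green_J_def using J by metis
qed

lemma sandwich_regular_iff:
  assumes X: "X \<in> carrier_mat m n" and J: "J \<in> carrier_mat n m"
  shows "(\<exists>Y\<in>carrier_mat m n. X = X * J * Y * J * X) \<longleftrightarrow>
    Col (X * J) = Col X \<and> Row (J * X) = Row X"
proof
  assume "\<exists>Y\<in>carrier_mat m n. X = X * J * Y * J * X"
  then obtain Y where Y: "Y \<in> carrier_mat m n" and eq: "X = X * J * Y * J * X" by blast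
  \<comment> \<open>Two bracketings of the regularity equation: one exhibits \<open>X * J\<close> as
    a left factor of \<open>X\<close>, the other \<open>J * X\<close> as a right factor.\<close>
  have "X * J * Y * J * X = X * J * (Y * J * X)" "X * J * Y * J * X = X * J * Y * (J * X)"
    using X Y J by (simp_all add: mult_mat_assoc)
  with eq have 1: "X = X * J * (Y * J * X)" and 2: "X = X * J * Y * (J * X)"
    by (metis, metis)
  show "Col (X * J) = Col X \<and> Row (J * X) = Row X"
    by (intro conjI Col_mult_eqI[OF _ _ 1] Row_mult_eqI[OF _ _ 2]) (use X Y J in simp_all)
next
  assume CR: "Col (X * J) = Col X \<and> Row (J * X) = Row X"
  have dJ: "dim_row J = dim_col X" "dim_col J = dim_row X" using X J by simp_all
  obtain A B where A: "A \<in> carrier_mat (dim_row X) (dim_col X)"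
    and B: "B \<in> carrier_mat (dim_row X) (dim_col X)"
    and XJ: "X * J = B * (J * X * J)" and JX: "J * X = J * X * J * A" and XA: "X = X * J * A"
    by (rule Col_Row_mult_eqE[OF dJ conjunct1[OF CR] conjunct2[OF CR]])
  define W where "W = J * X * J"
  have W: "W \<in> carrier_mat n m" using X J by (simp add: W_def)
  obtain Z where Z: "Z \<in> carrier_mat m n" "W * Z * W = W"
    by (rule von_Neumann_regular_mat[OF W])
  have "X * J * Z * J * X = X * J * Z * (J * X)"
    using X J Z(1) by (simp add: mult_mat_assoc)
  \<comment> \<open>Since \<open>X * J = B * W\<close> and \<open>J * X = W * A\<close>, an inner
    inverse of \<open>W\<close> collapses the product to \<open>B * W * A\<close>, which is
    \<open>X\<close>.\<close>
  also have "\<dots> = B * W * Z * (W * A)"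
    unfolding W_def XJ[symmetric] JX[symmetric] ..
  also have "\<dots> = B * (W * Z * W) * A"
    using A B W Z(1) X by (simp add: mult_mat_assoc)
  also have "\<dots> = X"
    unfolding Z(2) unfolding W_def XJ[symmetric] XA[symmetric] ..
  finally show "\<exists>Y\<in>carrier_mat m n. X = X * J * Y * J * X"
    using Z(1) by metis
qed

text \<open>The row condition passes to the product from its left factor and the column condition
  from its right factor: the multipliers that restore \<open>X\<close> and \<open>Y\<close> also
  restore \<open>X * J * Y\<close>.\<close>

lemma sandwich_mult_closed:
  assumes X: "X \<in> carrier_mat m n" and Y: "Y \<in> carrier_mat m n" and J: "J \<in> carrier_mat n m"
    and Row: "Row (J * X) = Row X" and Col: "Col (Y * J) = Col Y"
  shows "Row (J * (X * J * Y)) = Row (X * J * Y)" "Col (X * J * Y * J) = Col (X * J * Y)"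
proof -
  have "dim_col J = dim_row X" using X J by simp
  then obtain B where B: "B \<in> carrier_mat (dim_row X) (dim_row J)" "X = B * (J * X)"
    using Row by (rule Row_mult_eqE)
  have "X * J * Y = B * (J * X) * J * Y" using B(2) by (rule arg_cong)
  also have "\<dots> = B * (J * (X * J * Y))" using B(1) X Y J by (simp add: mult_mat_assoc)
  finally show "Row (J * (X * J * Y)) = Row (X * J * Y)"
    by (rule Row_mult_eqI[rotated 2]) (use B(1) X Y J in simp_all)
  obtain A where A: "A \<in> carrier_mat (dim_col J) (dim_col Y)" "Y = Y * J * A"
    using Col by (rule Col_mult_eqE)
  have "X * J * Y = X * J * (Y * J * A)" using A(2) by (rule arg_cong)
  also have "\<dots> = X * J * Y * J * A" using A(1) X Y J by (simp add: mult_mat_assoc)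
  finally show "Col (X * J * Y * J) = Col (X * J * Y)"
    by (rule Col_mult_eqI[rotated 2]) (use A(1) X Y J in simp_all)
qed

section \<open>Block decompositions and the shape \<open>[M, A, N]\<close>\<close>

lemma four_block_mat_inject:
  assumes "A \<in> carrier_mat r s" "B \<in> carrier_mat r q" "C \<in> carrier_mat p s" "D \<in> carrier_mat p q"
    and "A' \<in> carrier_mat r s" "B' \<in> carrier_mat r q" "C' \<in> carrier_mat p s" "D' \<in> carrier_mat p q"
  shows "four_block_mat A B C D = four_block_mat A' B' C' D' \<longleftrightarrow>
    A = A' \<and> B = B' \<and> C = C' \<and> D = D'"
proof
  \<comment> \<open>For blocks of known sizes, \<open>split_block\<close> undoes
    \<open>four_block_mat\<close>, hence injectivity.\<close>
  have split: "split_block (four_block_mat A B C D) r s = (A, B, C, D)"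
    if "A \<in> carrier_mat r s" "B \<in> carrier_mat r q" "C \<in> carrier_mat p s" "D \<in> carrier_mat p q"
    for A B C D :: "'a mat"
    using that by (auto simp: split_block_def Let_def intro: eq_matI)
  assume "four_block_mat A B C D = four_block_mat A' B' C' D'"
  then have "split_block (four_block_mat A B C D) r s = split_block (four_block_mat A' B' C' D') r s"
    by (rule arg_cong)
  then have "(A, B, C, D) = (A', B', C', D')"
    unfolding split[OF assms(1-4)] split[OF assms(5-8)] .
  then show "A = A' \<and> B = B' \<and> C = C' \<and> D = D'" by blast
qed simp

lemma Jmat_carrier: "r \<le> m \<Longrightarrow> r \<le> n \<Longrightarrow> Jmat m n r \<in> carrier_mat n m"
  unfolding Jmat_def by (rule carrier_matI) simp_all

lemma four_block_mult_Jmat: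
  assumes "r \<le> m" "r \<le> n" "A \<in> carrier_mat r r" "B \<in> carrier_mat r (n - r)"
    "C \<in> carrier_mat (m - r) r" "D \<in> carrier_mat (m - r) (n - r)"
  shows "four_block_mat A B C D * Jmat m n r =
    four_block_mat A (0\<^sub>m r (m - r)) C (0\<^sub>m (m - r) (m - r))"
  unfolding Jmat_def
  by (subst mult_four_block_mat[of _ r r _ "n - r" _ "m - r" _ _ r _ "m - r"])
     (use assms in auto)

lemma Jmat_mult_four_block:
  assumes "r \<le> m" "r \<le> n" "A \<in> carrier_mat r r" "B \<in> carrier_mat r (n - r)"
    "C \<in> carrier_mat (m - r) r" "D \<in> carrier_mat (m - r) (n - r)"
  shows "Jmat m n r * four_block_mat A B C D =
    four_block_mat A B (0\<^sub>m (n - r) r) (0\<^sub>m (n - r) (n - r))"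
  unfolding Jmat_def
  by (subst mult_four_block_mat[of _ r r _ "m - r" _ "n - r" _ _ r _ "n - r"])
     (use assms in auto)

lemma four_block_cases:
  assumes "X \<in> carrier_mat m n" "r \<le> m" "s \<le> n"
  obtains A B C D where "A \<in> carrier_mat r s" "B \<in> carrier_mat r (n - s)"
    "C \<in> carrier_mat (m - r) s" "D \<in> carrier_mat (m - r) (n - s)" "X = four_block_mat A B C D"
proof -
  obtain A B C D where "split_block X r s = (A, B, C, D)"
    by (metis prod_cases4)
  from split_block[OF this, of "m - r" "n - s"] assms that show thesis by simp
qed

lemma block_triple_carrier:
  assumes "r \<le> m" "r \<le> n" "A \<in> carrier_mat r r" "M \<in> carrier_mat (m - r) r" "N \<in> carrier_mat r (n - r)"
  shows "block_triple M A N \<in> carrier_mat m n"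
  unfolding block_triple_def by (rule carrier_matI) (use assms in simp_all)

text \<open>The equations \<open>X = X * J * G\<close> and \<open>X = H * (J * X)\<close> are
  compared block by block: \<open>N\<close> is the upper right block of \<open>G\<close> and
  \<open>M\<close> the lower left block of \<open>H\<close>.\<close>

lemma block_triple_iff:
  fixes X :: "'a::field mat"
  assumes r: "r \<le> m" "r \<le> n" and X: "X \<in> carrier_mat m n"
  shows "Col (X * Jmat m n r) = Col X \<and> Row (Jmat m n r * X) = Row X \<longleftrightarrow>
    (\<exists>M A N. X = block_triple M A N \<and>
      A \<in> carrier_mat r r \<and> M \<in> carrier_mat (m - r) r \<and> N \<in> carrier_mat r (n - r))"
proof
  let ?J = "Jmat m n r :: 'a mat"
  have J: "?J \<in> carrier_mat n m" using r by (rule Jmat_carrier)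
  {
    assume CR: "Col (X * ?J) = Col X \<and> Row (?J * X) = Row X"
    obtain A B C D where A: "A \<in> carrier_mat r r" and B: "B \<in> carrier_mat r (n - r)"
      and C: "C \<in> carrier_mat (m - r) r" and D: "D \<in> carrier_mat (m - r) (n - r)"
      and XABCD: "X = four_block_mat A B C D"
      by (rule four_block_cases[OF X r])
    obtain G where G: "G \<in> carrier_mat (dim_col ?J) (dim_col X)" "X = X * ?J * G"
      using conjunct1[OF CR] by (rule Col_mult_eqE)
    have "dim_col ?J = dim_row X" using X J by simp
    then obtain H where H: "H \<in> carrier_mat (dim_row X) (dim_row ?J)" "X = H * (?J * X)"
      using conjunct2[OF CR] by (rule Row_mult_eqE)
    have "G \<in> carrier_mat m n" using G(1) X J by simp
    then obtain G1 N G3 G4 where G1: "G1 \<in> carrier_mat r r" and N: "N \<in> carrier_mat r (n - r)"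
      and G3: "G3 \<in> carrier_mat (m - r) r" and G4: "G4 \<in> carrier_mat (m - r) (n - r)"
      and Gb: "G = four_block_mat G1 N G3 G4"
      using r by (rule four_block_cases)
    have "H \<in> carrier_mat m n" using H(1) X J by simp
    then obtain H1 H2 M H4 where H1: "H1 \<in> carrier_mat r r" and H2: "H2 \<in> carrier_mat r (n - r)"
      and M: "M \<in> carrier_mat (m - r) r" and H4: "H4 \<in> carrier_mat (m - r) (n - r)"
      and Hb: "H = four_block_mat H1 H2 M H4"
      using r by (rule four_block_cases)
    \<comment> \<open>The last \<open>m - r\<close> columns of \<open>X * ?J\<close> vanish, so only
      the upper blocks \<open>G1\<close> and \<open>N\<close> of \<open>G\<close> survive.\<close>
    have "X * ?J * G = four_block_mat (A * G1) (A * N) (C * G1) (C * N)"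
      unfolding XABCD four_block_mult_Jmat[OF r A B C D] Gb
      by (subst mult_four_block_mat[of _ r r _ "m - r" _ "m - r" _ _ r _ "n - r"])
         (use A B C D G1 N G3 G4 in auto)
    then have "four_block_mat A B C D = four_block_mat (A * G1) (A * N) (C * G1) (C * N)"
      using G(2) XABCD by metis
    then have BN: "B = A * N" "D = C * N"
      using four_block_mat_inject[of A r r B "n - r" C "m - r" D "A * G1" "A * N" "C * G1" "C * N"]
        A B C D G1 N by auto
    have "H * (?J * X) = four_block_mat (H1 * A) (H1 * B) (M * A) (M * B)"
      unfolding XABCD Jmat_mult_four_block[OF r A B C D] Hb
      by (subst mult_four_block_mat[of _ r r _ "n - r" _ "m - r" _ _ r _ "n - r"])
         (use A B C D H1 H2 M H4 in auto)
    then have "four_block_mat A B C D = four_block_mat (H1 * A) (H1 * B) (M * A) (M * B)"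
      using H(2) XABCD by metis
    \<comment> \<open>With \<open>D = C * N\<close> from the column equation, this makes the lower
      right block \<open>M * A * N\<close>.\<close>
    then have "C = M * A"
      using four_block_mat_inject[of A r r B "n - r" C "m - r" D "H1 * A" "H1 * B" "M * A" "M * B"]
        A B C D H1 M by auto
    with BN XABCD have "X = block_triple M A N" by (simp add: block_triple_def)
    with A M N show "\<exists>M A N. X = block_triple M A N \<and>
      A \<in> carrier_mat r r \<and> M \<in> carrier_mat (m - r) r \<and> N \<in> carrier_mat r (n - r)" by blast
  next
    assume "\<exists>M A N. X = block_triple M A N \<and>
      A \<in> carrier_mat r r \<and> M \<in> carrier_mat (m - r) r \<and> N \<in> carrier_mat r (n - r)"
    then obtain M A N where XMAN: "X = four_block_mat A (A * N) (M * A) (M * A * N)"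
      and A: "A \<in> carrier_mat r r" and M: "M \<in> carrier_mat (m - r) r"
      and N: "N \<in> carrier_mat r (n - r)"
      by (auto simp: block_triple_def)
    have blocks: "A * N \<in> carrier_mat r (n - r)" "M * A \<in> carrier_mat (m - r) r"
      "M * A * N \<in> carrier_mat (m - r) (n - r)"
      using A M N by simp_all
    \<comment> \<open>Multipliers for the converse: an identity corner reproduces the blocks already
      present, while \<open>N\<close> and \<open>M\<close> generate the missing columns and
      rows.\<close>
    let ?G = "four_block_mat (1\<^sub>m r) N (0\<^sub>m (m - r) r) (0\<^sub>m (m - r) (n - r))"
    let ?H = "four_block_mat (1\<^sub>m r) (0\<^sub>m r (n - r)) M (0\<^sub>m (m - r) (n - r))"
    have G: "X * ?J * ?G = X"
      unfolding XMAN four_block_mult_Jmat[OF r A blocks]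
      by (subst mult_four_block_mat[of _ r r _ "m - r" _ "m - r" _ _ r _ "n - r"])
         (use A M N in auto)
    have H: "?H * (?J * X) = X"
      unfolding XMAN Jmat_mult_four_block[OF r A blocks]
      by (subst mult_four_block_mat[of _ r r _ "n - r" _ "m - r" _ _ r _ "n - r"])
         (use A M N in \<open>auto simp: mult_mat_assoc\<close>)
    show "Col (X * ?J) = Col X \<and> Row (?J * X) = Row X"
      by (intro conjI Col_mult_eqI[OF _ _ G[symmetric]] Row_mult_eqI[OF _ _ H[symmetric]])
         (use X J M N r in simp_all)
  }
qed

section \<open>The descriptions of \<open>P1\<close>, \<open>P2\<close>, \<open>P3\<close> and
  \<open>P\<close>, regularity and closure\<close>

theorem proposition4p3:
  fixes m n r :: nat
  assumes "m \<ge> 1" and "n \<ge> 1" and "r \<le> min m n"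
  shows
   "((P1 m n r :: 'a::field mat set)
        = {X \<in> carrier_mat m n. mrank (X * Jmat m n r) = mrank X} \<and>
     (P1 m n r :: 'a mat set)
        = {X \<in> carrier_mat m n. Col (X * Jmat m n r) = Col X}) \<and>
    ((P2 m n r :: 'a mat set)
        = {X \<in> carrier_mat m n. mrank (Jmat m n r * X) = mrank X} \<and>
     (P2 m n r :: 'a mat set)
        = {X \<in> carrier_mat m n. Row (Jmat m n r * X) = Row X}) \<and>
    ((P3 m n r :: 'a mat set) = P m n r \<and>
     (P m n r :: 'a mat set)
        = {X \<in> carrier_mat m n. mrank (Jmat m n r * X * Jmat m n r) = mrank X} \<and>
     (P m n r :: 'a mat set)
        = {block_triple M A N | M A N.
             A \<in> carrier_mat r r \<and> M \<in> carrier_mat (m - r) r \<and> N \<in> carrier_mat r (n - r)}) \<and>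
    ((P m n r :: 'a mat set) = Reg (carrier_mat m n) (sandwich m n r) \<and>
     subsemigroup_on (P m n r :: 'a mat set) (carrier_mat m n) (sandwich m n r))"
proof -
  let ?J = "Jmat m n r :: 'a mat"
  let ?M = "carrier_mat m n :: 'a mat set"
  have r: "r \<le> m" "r \<le> n" using assms(3) by simp_all
  have J: "?J \<in> carrier_mat n m" using r by (rule Jmat_carrier)
  have P1_Col: "P1 m n r = {X \<in> ?M. Col (X * ?J) = Col X}"
    unfolding P1_def
    by (intro Collect_cong conj_cong refl green_R_iff_Col) (use J assms(1,2) in auto)
  have P1_rank: "P1 m n r = {X \<in> ?M. mrank (X * ?J) = mrank X}"
    unfolding P1_Col
    by (intro Collect_cong conj_cong refl Col_mult_eq_iff_mrank) (use J in auto)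
  have P2_Row: "P2 m n r = {X \<in> ?M. Row (?J * X) = Row X}"
    unfolding P2_def
    by (intro Collect_cong conj_cong refl green_L_iff_Row) (use J assms(1,2) in auto)
  have P2_rank: "P2 m n r = {X \<in> ?M. mrank (?J * X) = mrank X}"
    unfolding P2_Row
    by (intro Collect_cong conj_cong refl Row_mult_eq_iff_mrank) (use J in auto)
  \<comment> \<open>This form of \<open>P\<close> is the one to which the results on \<J>,
    regularity, closure and blocks apply.\<close>
  have P_eq: "P m n r = {X \<in> ?M. Col (X * ?J) = Col X \<and> Row (?J * X) = Row X}"
    unfolding P_def P1_Col P2_Row by blast
  have "P m n r = {X \<in> ?M. mrank (X * ?J) = mrank X \<and> mrank (?J * X) = mrank X}"
    unfolding P_def P1_rank P2_rank by blast
  also have "\<dots> = {X \<in> ?M. mrank (?J * X * ?J) = mrank X}"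
    by (intro Collect_cong conj_cong refl mrank_two_sided_eq_iff[symmetric]) (use J in auto)
  finally have P_rank: "P m n r = {X \<in> ?M. mrank (?J * X * ?J) = mrank X}" .
  have P3: "P3 m n r = (P m n r :: 'a mat set)"
  proof
    show "P3 m n r \<subseteq> (P m n r :: 'a mat set)"
      unfolding P_rank P3_def using green_J_imp_mrank_eq by blast
    show "(P m n r :: 'a mat set) \<subseteq> P3 m n r"
    proof
      fix X :: "'a mat" assume "X \<in> P m n r"
      then have X: "X \<in> ?M" "Col (X * ?J) = Col X" "Row (?J * X) = Row X"
        unfolding P_eq by blast+
      have "green_J (?J * X * ?J) X"
        by (rule green_J_two_sidedI[OF _ _ _ _ X(2,3)]) (use X(1) J assms(1,2) in simp_all)
      with X(1) show "X \<in> P3 m n r" unfolding P3_def by blast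
    qed
  qed
  have P_block: "P m n r = {block_triple M A N :: 'a mat | M A N.
      A \<in> carrier_mat r r \<and> M \<in> carrier_mat (m - r) r \<and> N \<in> carrier_mat r (n - r)}"
    unfolding P_eq using block_triple_iff[OF r] block_triple_carrier[OF r] by blast
  have P_Reg: "P m n r = Reg ?M (sandwich m n r)"
    unfolding P_eq Reg_def sandwich_def using sandwich_regular_iff[OF _ J] by blast
  have "semigroup_on ?M (sandwich m n r)"
    unfolding semigroup_on_def sandwich_def using J by (auto simp: mult_mat_assoc)
  \<comment> \<open>\<open>subsemigroup_on\<close> demands a nonempty set; the zero matrix is a
    member.\<close>
  moreover have "block_triple (0\<^sub>m (m - r) r) (0\<^sub>m r r) (0\<^sub>m r (n - r)) \<in> (P m n r :: 'a mat set)"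
    unfolding P_block by (auto intro: zero_carrier_mat)
  moreover have "\<forall>X\<in>P m n r. \<forall>Y\<in>P m n r. sandwich m n r X Y \<in> (P m n r :: 'a mat set)"
    unfolding P_eq sandwich_def using sandwich_mult_closed[OF _ _ J] J
    by (blast intro: mult_carrier_mat)
  ultimately have "subsemigroup_on (P m n r) ?M (sandwich m n r)"
    unfolding subsemigroup_on_def using P_eq by blast
  with P1_rank P1_Col P2_rank P2_Row P3 P_rank P_block P_Reg show ?thesis
    by (intro conjI)
qed

end
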